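(* Let $p$ and $q$ be distinct prime numbers. Then there is an injective function from the lattice of all clones containing $\mathrm{Clo}(\langle \mathbb{Z}_{pq},+\rangle)$ that preserve $\pi_1$ and $[\pi_1,\pi_1]=0$ to the direct product of the lattice of all clones on $\mathbb{Z}_p$ containing $\mathrm{Clo}(\langle \mathbb{Z}_p,+\rangle)$ and the square of the lattice of all $(\mathbb{Z}_q,\mathbb{Z}_p)$-linearly closed clonoids.
   Context: $\mathbb{N}$ is the set of positive integers. A clone on a set $A$ is a set of finitary operations on $A$ containing all projections and closed under composition. $\mathrm{Clo}(\langle \mathbb{Z}_n,+\rangle)$ is the clone on $\mathbb{Z}_n$ generated by the addition. $\mathbb{Z}_{pq}$ is identified with $\mathbb{Z}_p\times\mathbb{Z}_q$; $\pi_1$ is the kernel (equivalence relation) of the projection $\mathbb{Z}_p\times\mathbb{Z}_q\to\mathbb{Z}_p$, and $0$ is the equality relation on $\mathbb{Z}_p\times\mathbb{Z}_q$. An operation $f$ on $A$ preserves a relation $R\subseteq A^m$ if applying $f$ coordinatewise to tuples of $R$ always yields a tuple of $R$; a clone preserves something if all its members do. An operation on $\mathbb{Z}_p\times\mathbb{Z}_q$ preserves $[\pi_1,\pi_1]=0$ (equivalently written $[\pi_1,\pi_1]\le 0$) if it preserves the $4$-ary relation $\{(a,b,c,d)\in(\mathbb{Z}_p\times\mathbb{Z}_q)^4 \mid a\,\pi_1\,b,\ b\,\pi_1\,c,\ a-b+c=d\}$. For a set $C\subseteq \bigcup_{n\in\mathbb{N}}\mathbb{Z}_q^{\mathbb{Z}_p^n}$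 let $C^{[n]}$ be the set of its $n$-ary members. A $(\mathbb{Z}_q,\mathbb{Z}_p)$-linearly closed clonoid is a non-empty subset $C$ of $\bigcup_{n\in\mathbb{N}}\mathbb{Z}_q^{\mathbb{Z}_p^n}$ such that: (1) for all $n\in\mathbb{N}$, $f,g\in C^{[n]}$ and $a,b\in\mathbb{Z}_q$: $af+bg\in C^{[n]}$; (2) for all $m,n\in\mathbb{N}$, $f\in C^{[m]}$ and $A\in\mathbb{Z}_p^{m\times n}$, the function $(x_1,\dots,x_n)\mapsto f(A\cdot(x_1,\dots,x_n)^t)$ is in $C^{[n]}$. These clonoids form a lattice under inclusion. *)

theory Defs
  imports "HOL-Algebra.Chinese_Remainder" "HOL-Number_Theory.Residues"
begin

text \<open>
  An \<open>n\<close>-tuple over \<open>A\<close> is a list of length \<open>n\<close>, with coordinates numbered from \<open>0\<close>. A finitary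
  function carries its arity explicitly, and its graph is extensional on the tuples of that length,
  so that equality of pairs \<open>(n, f)\<close> is equality of finitary functions and functions of different
  arities are always distinct.
\<close>

type_synonym ('a, 'b) fin_fun = "nat \<times> ('a list \<Rightarrow> 'b)"

definition tuples :: "'a set \<Rightarrow> nat \<Rightarrow> 'a list set" where
  "tuples A n = {xs. length xs = n \<and> set xs \<subseteq> A}"

definition fin_funs :: "'a set \<Rightarrow> 'b set \<Rightarrow> ('a, 'b) fin_fun set" where
  "fin_funs A B = {(n, f). 1 \<le> n \<and> f \<in> tuples A n \<rightarrow>\<^sub>E B}"

definition projection :: "'a set \<Rightarrow> nat \<Rightarrow> nat \<Rightarrow> ('a, 'a) fin_fun" where
  "projection A n i = (n, \<lambda>xs\<in>tuples A n. xs ! i)"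

text \<open>
  In \<open>is_clone\<close> below, \<open>f\<close> has arity \<open>length gs\<close>, and the composite
  \<open>f(g\<^sub>0, \<dots>, g\<^sub>m\<^sub>-\<^sub>1)\<close> has the common arity \<open>n\<close> of the inner operations.
\<close>

definition compose_op ::
  "'a set \<Rightarrow> nat \<Rightarrow> ('a list \<Rightarrow> 'a) \<Rightarrow> ('a list \<Rightarrow> 'a) list \<Rightarrow> ('a, 'a) fin_fun" where
  "compose_op A n f gs = (n, \<lambda>xs\<in>tuples A n. f (map (\<lambda>g. g xs) gs))"

definition is_clone :: "'a set \<Rightarrow> ('a, 'a) fin_fun set \<Rightarrow> bool" where
  "is_clone A C \<longleftrightarrow>
     C \<subseteq> fin_funs A A \<and>
     (\<forall>n i. i < n \<longrightarrow> projection A n i \<in> C) \<and>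
     (\<forall>n f gs. (length gs, f) \<in> C \<and> (\<forall>g\<in>set gs. (n, g) \<in> C) \<longrightarrow> compose_op A n f gs \<in> C)"

definition generated_clone :: "'a set \<Rightarrow> ('a, 'a) fin_fun set \<Rightarrow> ('a, 'a) fin_fun set" where
  "generated_clone A F = \<Inter>{C. is_clone A C \<and> F \<subseteq> C}"

definition addition_op :: "('a, 'm) ring_scheme \<Rightarrow> ('a, 'a) fin_fun" where
  "addition_op R = (2, \<lambda>xs\<in>tuples (carrier R) 2. xs ! 0 \<oplus>\<^bsub>R\<^esub> xs ! 1)"

definition Clo_add :: "('a, 'm) ring_scheme \<Rightarrow> ('a, 'a) fin_fun set" where
  "Clo_add R = generated_clone (carrier R) {addition_op R}"

definition clones_above_add :: "('a, 'm) ring_scheme \<Rightarrow> ('a, 'a) fin_fun set set" where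
  "clones_above_add R = {C. is_clone (carrier R) C \<and> Clo_add R \<subseteq> C}"

text \<open>
  An \<open>m\<close>-ary relation is a set of lists of length \<open>m\<close>. The list \<open>ts\<close> consists of \<open>n\<close> tuples of the
  relation, and the operation is applied to the \<open>i\<close>-th entries of these tuples, for each \<open>i < m\<close>.
\<close>

definition preserves :: "('a, 'a) fin_fun \<Rightarrow> nat \<Rightarrow> 'a list set \<Rightarrow> bool" where
  "preserves h m R \<longleftrightarrow>
     (\<forall>ts. length ts = fst h \<and> set ts \<subseteq> R \<longrightarrow> map (\<lambda>i. snd h (map (\<lambda>t. t ! i) ts)) [0..<m] \<in> R)"

definition clone_preserves :: "('a, 'a) fin_fun set \<Rightarrow> nat \<Rightarrow> 'a list set \<Rightarrow> bool" where
  "clone_preserves C m R \<longleftrightarrow> (\<forall>h\<in>C. preserves h m R)"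

abbreviation Zmod :: "nat \<Rightarrow> int ring" where
  "Zmod n \<equiv> residue_ring (int n)"

text \<open>For distinct primes \<open>p\<close> and \<open>q\<close>, the ring of integers modulo \<open>p * q\<close> is identified with
  the following product by the Chinese remainder theorem.\<close>

abbreviation Zprod :: "nat \<Rightarrow> nat \<Rightarrow> (int \<times> int) ring" where
  "Zprod p q \<equiv> RDirProd (Zmod p) (Zmod q)"

definition pi1 :: "nat \<Rightarrow> nat \<Rightarrow> ((int \<times> int) \<times> (int \<times> int)) set" where
  "pi1 p q = {(a, b). a \<in> carrier (Zprod p q) \<and> b \<in> carrier (Zprod p q) \<and> fst a = fst b}"

definition preserves_pi1 :: "nat \<Rightarrow> nat \<Rightarrow> (int \<times> int, int \<times> int) fin_fun set \<Rightarrow> bool" where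
  "preserves_pi1 p q C \<longleftrightarrow> clone_preserves C 2 {[a, b] | a b. (a, b) \<in> pi1 p q}"

text \<open>Preservation of \<open>[\<pi>\<^sub>1, \<pi>\<^sub>1] = 0\<close>, where the bracket is the commutator of congruences.\<close>

definition preserves_pi1_commutator ::
  "nat \<Rightarrow> nat \<Rightarrow> (int \<times> int, int \<times> int) fin_fun set \<Rightarrow> bool" where
  "preserves_pi1_commutator p q C \<longleftrightarrow>
     clone_preserves C 4
       {[a, b, c, d] | a b c d.
          a \<in> carrier (Zprod p q) \<and> b \<in> carrier (Zprod p q) \<and>
          c \<in> carrier (Zprod p q) \<and> d \<in> carrier (Zprod p q) \<and>
          (a, b) \<in> pi1 p q \<and> (b, c) \<in> pi1 p q \<and>
          (a \<ominus>\<^bsub>Zprod p q\<^esub> b) \<oplus>\<^bsub>Zprod p q\<^esub> c = d}"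

text \<open>The matrix entry in row \<open>i\<close> and column \<open>j\<close> is \<open>M i j\<close>; only \<open>i < m\<close> and \<open>j < n\<close> matter for
  an \<open>m \<times> n\<close> matrix.\<close>

definition mat_vec :: "('b, 'k) ring_scheme \<Rightarrow> nat \<Rightarrow> nat \<Rightarrow> (nat \<Rightarrow> nat \<Rightarrow> 'b) \<Rightarrow> 'b list \<Rightarrow> 'b list" where
  "mat_vec K m n M xs = map (\<lambda>i. \<Oplus>\<^bsub>K\<^esub>j\<in>{..<n}. M i j \<otimes>\<^bsub>K\<^esub> xs ! j) [0..<m]"

text \<open>\<open>(F, K)\<close>-linearly closed clonoids consist of functions from powers of \<open>K\<close> to \<open>F\<close>.\<close>

definition lin_closed_clonoid ::
  "('a, 'm) ring_scheme \<Rightarrow> ('b, 'k) ring_scheme \<Rightarrow> ('b, 'a) fin_fun set \<Rightarrow> bool" where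
  "lin_closed_clonoid F K C \<longleftrightarrow>
     C \<noteq> {} \<and> C \<subseteq> fin_funs (carrier K) (carrier F) \<and>
     (\<forall>n f g a b. (n, f) \<in> C \<and> (n, g) \<in> C \<and> a \<in> carrier F \<and> b \<in> carrier F \<longrightarrow>
        (n, \<lambda>xs\<in>tuples (carrier K) n. (a \<otimes>\<^bsub>F\<^esub> f xs) \<oplus>\<^bsub>F\<^esub> (b \<otimes>\<^bsub>F\<^esub> g xs)) \<in> C) \<and>
     (\<forall>m n f M. 1 \<le> n \<and> (m, f) \<in> C \<and> (\<forall>i<m. \<forall>j<n. M i j \<in> carrier K) \<longrightarrow>
        (n, \<lambda>xs\<in>tuples (carrier K) n. f (mat_vec K m n M xs)) \<in> C)"

definition lin_closed_clonoids :: "('a, 'm) ring_scheme \<Rightarrow> ('b, 'k) ring_scheme \<Rightarrow> ('b, 'a) fin_fun set set"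
  where "lin_closed_clonoids F K = {C. lin_closed_clonoid F K C}"

end

theory Submission
  imports Defs
begin

text \<open>
  An operation \<open>f\<close> on \<open>\<int>\<^sub>p \<times> \<int>\<^sub>q\<close> that preserves \<open>\<pi>\<^sub>1\<close> has a first component \<open>f\<^sub>1(x)\<close> depending only on
  the vector \<open>x\<close> of first coordinates of its arguments. Preserving \<open>[\<pi>\<^sub>1, \<pi>\<^sub>1] = 0\<close> says that, for
  fixed \<open>x\<close>, the second component respects \<open>a - b + c\<close>, so it is affine in the vector \<open>y\<close> of second
  coordinates. Hence
  \<open>f(x, y) = (f\<^sub>1(x), h(x) + g\<^sub>1(x) y\<^sub>1 + \<dots> + g\<^sub>n(x) y\<^sub>n)\<close>
  with \<open>h, g\<^sub>1, \<dots>, g\<^sub>n : \<int>\<^sub>p\<^sup>n \<rightarrow> \<int>\<^sub>q\<close>.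

  By the Chinese remainder theorem, every map \<open>(x, y) \<mapsto> (c x, d y)\<close> is a multiple of the identity and
  so belongs to each clone \<open>C\<close> containing the addition (\<open>has_op_scale\<close>). With the two coordinate
  projections \<open>(x, y) \<mapsto> (x, 0)\<close> and \<open>(x, y) \<mapsto> (0, y)\<close> one can therefore cut \<open>f\<close> into the pieces
  \<open>(f\<^sub>1(x), 0)\<close>, \<open>(0, h(x))\<close> and \<open>(0, g\<^sub>k(x) y\<^sub>k)\<close> without leaving \<open>C\<close>. In the last piece \<open>y\<^sub>k\<close> may be
  made independent of \<open>x\<close>, by substituting \<open>(x\<^sub>k, y\<^sub>n\<^sub>+\<^sub>1)\<close> for the \<open>k\<close>-th argument; this turns it into
  \<open>(0, g\<^sub>k(x\<^sub>1, \<dots>, x\<^sub>n) y\<^sub>n\<^sub>+\<^sub>1)\<close>, whose shape is the same for all \<open>k\<close>. Accordingly \<open>C\<close> is mapped to the set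
  of all \<open>f\<close> with \<open>(f(x), 0)\<close> in \<open>C\<close> (\<open>base_part\<close>), the set of all \<open>h\<close> with \<open>(0, h(x))\<close> in \<open>C\<close>
  (\<open>const_part\<close>), and the set of all \<open>g\<close> with \<open>(0, g(x) y\<^sub>n\<^sub>+\<^sub>1)\<close> in \<open>C\<close> (\<open>coeff_part\<close>). These are a
  clone above the addition of \<open>\<int>\<^sub>p\<close> and two linearly closed clonoids, because linear combinations and
  linear substitutions in the \<open>x\<close>-coordinates are compositions with members of \<open>C\<close>.

  The map is injective, and even reflects inclusion (\<open>clone_subset_of_parts_subset\<close>): if the three
  parts of \<open>C\<close> lie in those of \<open>D\<close>, then all pieces of an operation \<open>f\<close> of \<open>C\<close> belong to \<open>D\<close>, and
  \<open>f\<close> is their sum.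
\<close>

section \<open>Tuples and preserved relations\<close>

lemma tuples_nth: "xs \<in> tuples K n \<Longrightarrow> i < n \<Longrightarrow> xs ! i \<in> K"
  by (auto simp: tuples_def)

lemma preservesD:
  "preserves (n, f) m R \<Longrightarrow> length ts = n \<Longrightarrow> set ts \<subseteq> R \<Longrightarrow>
    map (\<lambda>i. f (map (\<lambda>t. t ! i) ts)) [0..<m] \<in> R"
  by (simp add: preserves_def)

section \<open>Arithmetic in the rings of integers modulo p and q and in their product\<close>

lemma Zmod_carrier_iff: "x \<in> carrier (Zmod n) \<longleftrightarrow> 0 \<le> x \<and> x < int n"
  by (auto simp: residue_ring_def)

lemma Zmod_add: "x \<oplus>\<^bsub>Zmod n\<^esub> y = (x + y) mod int n"
  by (simp add: residue_ring_def)

lemma Zmod_mult: "x \<otimes>\<^bsub>Zmod n\<^esub> y = (x * y) mod int n"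
  by (simp add: residue_ring_def)

lemma Zmod_zero: "\<zero>\<^bsub>Zmod n\<^esub> = 0"
  by (simp add: residue_ring_def)

lemma Zprod_add:
  "a \<oplus>\<^bsub>Zprod m n\<^esub> b = ((fst a + fst b) mod int m, (snd a + snd b) mod int n)"
  by (cases a, cases b)
    (simp add: RDirProd_def DirProd_def monoid.defs Zmod_add)

lemma Zprod_zero: "\<zero>\<^bsub>Zprod m n\<^esub> = (0, 0)"
  by (simp add: RDirProd_def DirProd_def monoid.defs Zmod_zero)

lemma Zprod_carrier_iff:
  "a \<in> carrier (Zprod m n) \<longleftrightarrow> fst a \<in> carrier (Zmod m) \<and> snd a \<in> carrier (Zmod n)"
  by (cases a) (simp add: RDirProd_carrier)

lemma mod_lin_comb:
  "(a * (x mod c) + b * (y mod c)) mod c = (a * x + b * y) mod (c :: int)"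
  by (metis mod_add_eq mod_mult_right_eq)

lemma mod_diff_add_left: "(x mod c - b + a) mod c = (x - b + a) mod (c :: int)"
  by (metis mod_add_left_eq mod_diff_left_eq)

lemma Zmod_mod_in_carrier: "1 < n \<Longrightarrow> x mod int n \<in> carrier (Zmod n)"
  by (simp add: Zmod_carrier_iff)

lemma Zmod_mod_id: "x \<in> carrier (Zmod n) \<Longrightarrow> x mod int n = x"
  by (simp add: Zmod_carrier_iff)

locale coprime_moduli =
  fixes p q :: nat
  assumes p_gt_1: "1 < p" and q_gt_1: "1 < q" and coprime_pq: "coprime p q"
begin

abbreviation A :: "(int \<times> int) set" where "A \<equiv> carrier (Zprod p q)"

lemma Zprod_minus:
  assumes "a \<in> A" "b \<in> A"
  shows "a \<ominus>\<^bsub>Zprod p q\<^esub> b = ((fst a - fst b) mod int p, (snd a - snd b) mod int q)"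
proof -
  interpret P: residues "int p" "Zmod p" by unfold_locales (use p_gt_1 in simp_all)
  interpret Q: residues "int q" "Zmod q" by unfold_locales (use q_gt_1 in simp_all)
  interpret R: ring "Zprod p q"
    by (rule RDirProd_ring) (rule P.ring_axioms, rule Q.ring_axioms)
  let ?c = "((- fst b) mod int p, (- snd b) mod int q)"
  have "?c \<in> A"
    using p_gt_1 q_gt_1 by (simp add: Zprod_carrier_iff Zmod_mod_in_carrier)
  moreover have "?c \<oplus>\<^bsub>Zprod p q\<^esub> b = \<zero>\<^bsub>Zprod p q\<^esub>"
    by (simp add: Zprod_add Zprod_zero mod_simps)
  ultimately have "\<ominus>\<^bsub>Zprod p q\<^esub> b = ?c"
    using assms by (intro R.minus_equality)
  then show ?thesis
    by (simp add: a_minus_def Zprod_add mod_simps)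
qed

section \<open>Closure properties of clones above the addition\<close>

text \<open>
  Membership in a clone for functions whose values off \<open>tuples A n\<close> are arbitrary, so that operations
  can be written as plain lambda terms.
\<close>

definition has_op where
  "has_op C n F \<longleftrightarrow> (n, restrict F (tuples A n)) \<in> C"

lemma has_op_cong:
  assumes "has_op C n F" "\<And>xs. xs \<in> tuples A n \<Longrightarrow> F xs = G xs"
  shows "has_op C n G"
proof -
  have "restrict F (tuples A n) = restrict G (tuples A n)"
    using assms(2) by (auto simp: restrict_def fun_eq_iff)
  then show ?thesis using assms(1) by (simp add: has_op_def)
qed

context
  fixes C assumes C: "C \<in> clones_above_add (Zprod p q)"
begin

lemma clone_C: "is_clone A C"
  using C by (simp add: clones_above_add_def)

lemma has_op_iff: "(n, f) \<in> C \<longleftrightarrow> f \<in> extensional (tuples A n) \<and> has_op C n f"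
proof -
  have "(n, f) \<in> C \<Longrightarrow> f \<in> extensional (tuples A n)"
    using clone_C by (auto simp: is_clone_def fin_funs_def PiE_def)
  then show ?thesis by (auto simp: has_op_def extensional_restrict)
qed

lemma has_op_arity: "has_op C n F \<Longrightarrow> 1 \<le> n"
  using clone_C by (auto simp: is_clone_def fin_funs_def has_op_def)

lemma has_op_closed: "has_op C n F \<Longrightarrow> xs \<in> tuples A n \<Longrightarrow> F xs \<in> A"
proof -
  assume "has_op C n F" and xs: "xs \<in> tuples A n"
  then have "(n, restrict F (tuples A n)) \<in> fin_funs A A"
    using clone_C by (auto simp: is_clone_def has_op_def)
  then have "restrict F (tuples A n) \<in> tuples A n \<rightarrow>\<^sub>E A"
    by (simp add: fin_funs_def)
  from PiE_mem[OF this xs] show "F xs \<in> A" using xs by simp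
qed

lemma has_op_proj: "i < n \<Longrightarrow> has_op C n (\<lambda>xs. xs ! i)"
  using clone_C by (auto simp: is_clone_def has_op_def projection_def)

lemma has_op_compose:
  assumes F: "has_op C m F" and G: "\<And>i. i < m \<Longrightarrow> has_op C n (G i)"
  shows "has_op C n (\<lambda>xs. F (map (\<lambda>i. G i xs) [0..<m]))"
proof -
  let ?gs = "map (\<lambda>i. restrict (G i) (tuples A n)) [0..<m]"
  have "compose_op A n (restrict F (tuples A m)) ?gs \<in> C"
    using clone_C F G unfolding is_clone_def has_op_def by auto
  moreover have "compose_op A n (restrict F (tuples A m)) ?gs =
      (n, \<lambda>xs\<in>tuples A n. F (map (\<lambda>i. G i xs) [0..<m]))"
  proof -
    have "map (\<lambda>i. G i xs) [0..<m] \<in> tuples A m" if "xs \<in> tuples A n" for xs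
      using has_op_closed[OF G that] by (auto simp: tuples_def)
    then show ?thesis
      by (auto simp: compose_op_def fun_eq_iff restrict_def comp_def)
  qed
  ultimately show ?thesis by (simp add: has_op_def)
qed

lemma has_op_add:
  assumes "has_op C n F" "has_op C n G"
  shows "has_op C n (\<lambda>xs. ((fst (F xs) + fst (G xs)) mod int p, (snd (F xs) + snd (G xs)) mod int q))"
proof -
  have "addition_op (Zprod p q) \<in> C"
    using C by (auto simp: clones_above_add_def Clo_add_def generated_clone_def)
  then have add: "has_op C 2 (\<lambda>xs. xs ! 0 \<oplus>\<^bsub>Zprod p q\<^esub> xs ! 1)"
    by (simp add: addition_op_def has_op_def)
  show ?thesis
    using has_op_compose[OF add, of n "\<lambda>i. if i = 0 then F else G"] assms
    by (simp add: Zprod_add upt_rec numeral_2_eq_2)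
qed

text \<open>
  Multiplication by an integer \<open>k\<close> is iterated addition, and since \<open>p\<close> and \<open>q\<close> are coprime the residues
  of \<open>k\<close> modulo \<open>p\<close> and \<open>q\<close> can be prescribed independently.
\<close>

lemma has_op_scale:
  assumes F: "has_op C n F"
  shows "has_op C n (\<lambda>xs. ((c * fst (F xs)) mod int p, (d * snd (F xs)) mod int q))"
proof -
  have pos: "has_op C n (\<lambda>xs. ((int (Suc k) * fst (F xs)) mod int p, (int (Suc k) * snd (F xs)) mod int q))"
    for k
  proof (induction k)
    case 0
    show ?case
      using has_op_closed[OF F]
      by (intro has_op_cong[OF F]) (auto simp: Zprod_carrier_iff Zmod_mod_id prod_eq_iff)
  next
    case (Suc k)
    show ?case
      by (rule has_op_cong[OF has_op_add[OF Suc F]]) (simp add: mod_simps algebra_simps)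
  qed
  obtain k where k: "[k = c] (mod int p)" "[k = d] (mod int q)"
    using binary_chinese_remainder_int[of "int p" "int q" c d] coprime_pq by auto
  \<comment> \<open>A clone has no nullary members, so only positive multiples come from repeated addition;
    \<open>k\<close> may be moved to a positive representative modulo \<open>p * q\<close>.\<close>
  define l where "l = k mod (int p * int q) + int p * int q"
  have l: "0 < l" "[l = c] (mod int p)" "[l = d] (mod int q)"
  proof -
    show "0 < l"
      unfolding l_def using p_gt_1 q_gt_1 by (intro add_nonneg_pos) auto
    show "[l = c] (mod int p)" "[l = d] (mod int q)"
      using k by (simp_all add: l_def cong_def mod_mod_cancel)
  qed
  have "int (Suc (nat l - 1)) = l" using l(1) by simp
  then show ?thesis
    using pos[of "nat l - 1"] cong_mult[OF l(2) cong_refl] cong_mult[OF l(3) cong_refl]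
    by (simp add: cong_def)
qed

lemma has_op_fst: "has_op C n F \<Longrightarrow> has_op C n (\<lambda>xs. (fst (F xs), 0))"
  by (rule has_op_cong[OF has_op_scale[of n F 1 0]])
    (auto dest: has_op_closed simp: Zprod_carrier_iff Zmod_mod_id)

lemma has_op_snd: "has_op C n F \<Longrightarrow> has_op C n (\<lambda>xs. (0, snd (F xs)))"
  by (rule has_op_cong[OF has_op_scale[of n F 0 1]])
    (auto dest: has_op_closed simp: Zprod_carrier_iff Zmod_mod_id)

lemma has_op_pair:
  assumes "has_op C n (\<lambda>xs. (f xs, 0))" "has_op C n (\<lambda>xs. (0, g xs))"
  shows "has_op C n (\<lambda>xs. (f xs, g xs))"
  using has_op_closed[OF assms(1)] has_op_closed[OF assms(2)]
  by (intro has_op_cong[OF has_op_add[OF assms]])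
    (auto simp: Zprod_carrier_iff Zmod_mod_id)

lemma has_op_zero: "1 \<le> n \<Longrightarrow> has_op C n (\<lambda>xs. (0, 0))"
  using has_op_scale[OF has_op_proj, of 0 n 0 0] by simp

lemma has_op_lin_comb:
  assumes "has_op C n (\<lambda>xs. (0, f xs))" "has_op C n (\<lambda>xs. (0, g xs))"
  shows "has_op C n (\<lambda>xs. (0, (a * f xs + b * g xs) mod int q))"
  using has_op_add[OF has_op_scale[OF assms(1), of 0 a] has_op_scale[OF assms(2), of 0 b]]
  by (simp add: mod_simps)

lemma has_op_mult_fst:
  "has_op C n (\<lambda>xs. (u xs, 0)) \<Longrightarrow> has_op C n (\<lambda>xs. (c * u xs mod int p, 0))"
  using has_op_scale[of n "\<lambda>xs. (u xs, 0)" c 0] by simp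

lemma has_op_finsum_fst:
  assumes "finite J" "1 \<le> n" "\<And>j. j \<in> J \<Longrightarrow> has_op C n (\<lambda>xs. (u j xs, 0))"
  shows "has_op C n (\<lambda>xs. (\<Oplus>\<^bsub>Zmod p\<^esub>j\<in>J. u j xs, 0))"
  using assms
proof (induction J)
  case empty
  interpret P: residues "int p" "Zmod p" by unfold_locales (use p_gt_1 in simp_all)
  show ?case using has_op_zero[OF empty(1)] by (simp add: Zmod_zero)
next
  case (insert j J)
  interpret P: residues "int p" "Zmod p" by unfold_locales (use p_gt_1 in simp_all)
  have j: "has_op C n (\<lambda>xs. (u j xs, 0))" using insert.prems by simp
  have IH: "has_op C n (\<lambda>xs. (\<Oplus>\<^bsub>Zmod p\<^esub>j\<in>J. u j xs, 0))"
    using insert by simp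
  show ?case
  proof (rule has_op_cong[OF has_op_add[OF j IH]])
    fix xs assume xs: "xs \<in> tuples A n"
    have "u i xs \<in> carrier (Zmod p)" if "i \<in> insert j J" for i
      using has_op_closed[OF insert.prems(2)[OF that] xs] by (simp add: Zprod_carrier_iff)
    then have "(\<Oplus>\<^bsub>Zmod p\<^esub>i\<in>insert j J. u i xs) = u j xs \<oplus>\<^bsub>Zmod p\<^esub> (\<Oplus>\<^bsub>Zmod p\<^esub>i\<in>J. u i xs)"
      using insert.hyps by (intro P.finsum_insert) auto
    then show "((fst (u j xs, 0::int) + fst (\<Oplus>\<^bsub>Zmod p\<^esub>j\<in>J. u j xs, 0::int)) mod int p,
        (snd (u j xs, 0) + snd (\<Oplus>\<^bsub>Zmod p\<^esub>j\<in>J. u j xs, 0)) mod int q) =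
        (\<Oplus>\<^bsub>Zmod p\<^esub>j\<in>insert j J. u j xs, 0)"
      by (simp add: Zmod_add)
  qed
qed

text \<open>
  The vectors \<open>X xs\<close> are left abstract because \<open>const_part\<close> needs this for all first coordinates of
  \<open>xs\<close>, whereas \<open>coeff_part\<close> needs it for all but the last.
\<close>

lemma has_op_mat_vec:
  assumes "1 \<le> N" "i < m" "\<And>j. j < n \<Longrightarrow> has_op C N (\<lambda>xs. (X xs ! j, 0))"
  shows "has_op C N (\<lambda>xs. (mat_vec (Zmod p) m n M (X xs) ! i, 0))"
proof -
  have "has_op C N (\<lambda>xs. (M i j \<otimes>\<^bsub>Zmod p\<^esub> X xs ! j, 0))" if "j < n" for j
    using has_op_mult_fst[OF assms(3)[OF that]] by (simp add: Zmod_mult)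
  then have "has_op C N (\<lambda>xs. (\<Oplus>\<^bsub>Zmod p\<^esub>j\<in>{..<n}. M i j \<otimes>\<^bsub>Zmod p\<^esub> X xs ! j, 0))"
    using assms(1) by (intro has_op_finsum_fst) auto
  then show ?thesis using assms(2) by (simp add: mat_vec_def)
qed

end

section \<open>The clone and the two clonoids of a clone\<close>

definition base_part where
  "base_part C = {(n, f). (n, f) \<in> fin_funs (carrier (Zmod p)) (carrier (Zmod p)) \<and>
     has_op C n (\<lambda>xs. (f (map fst xs), 0))}"

definition const_part where
  "const_part C = {(n, h). (n, h) \<in> fin_funs (carrier (Zmod p)) (carrier (Zmod q)) \<and>
     has_op C n (\<lambda>xs. (0, h (map fst xs)))}"

text \<open>
  The factor from \<open>\<int>\<^sub>q\<close> has an argument of its own. If it were the second coordinate of one of the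
  arguments of \<open>g\<close>, a linear substitution for the first coordinates would act on it as well.
\<close>

definition coeff_part where
  "coeff_part C = {(n, g). (n, g) \<in> fin_funs (carrier (Zmod p)) (carrier (Zmod q)) \<and>
     has_op C (Suc n) (\<lambda>xs. (0, g (map fst (take n xs)) * snd (xs ! n) mod int q))}"

lemma map_fst_tuples: "xs \<in> tuples A n \<Longrightarrow> map fst xs \<in> tuples (carrier (Zmod p)) n"
  by (auto simp: tuples_def Zprod_carrier_iff)

lemma map_fst_take_tuples:
  "xs \<in> tuples A (Suc n) \<Longrightarrow> map fst (take n xs) \<in> tuples (carrier (Zmod p)) n"
  by (auto simp: tuples_def Zprod_carrier_iff dest!: in_set_takeD)

lemma mat_vec_tuples:
  assumes "\<forall>i<m. \<forall>j<n. M i j \<in> carrier (Zmod p)" "xs \<in> tuples (carrier (Zmod p)) n"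
  shows "mat_vec (Zmod p) m n M xs \<in> tuples (carrier (Zmod p)) m"
proof -
  interpret P: residues "int p" "Zmod p" by unfold_locales (use p_gt_1 in simp_all)
  have "xs ! j \<in> carrier (Zmod p)" if "j < n" for j
    using assms(2) that by (auto simp: tuples_def)
  then show ?thesis
    using assms(1) by (auto simp: mat_vec_def tuples_def intro!: P.finsum_closed P.m_closed)
qed

text \<open>
  On operations \<open>(f(x), 0)\<close>, composition in \<open>C\<close> is composition of the first components, since the outer
  operation reads only the first coordinates of the inner ones.
\<close>

lemma base_part_clone:
  assumes C: "C \<in> clones_above_add (Zprod p q)"
  shows "base_part C \<in> clones_above_add (Zmod p)"
proof -
  let ?P = "carrier (Zmod p)"
  have proj: "projection ?P n i \<in> base_part C" if "i < n" for n i
  proof -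
    have "has_op C n (\<lambda>xs. ((\<lambda>xs\<in>tuples ?P n. xs ! i) (map fst xs), 0))"
      by (rule has_op_cong[OF has_op_fst[OF C has_op_proj[OF C that]]])
        (use that in \<open>simp add: map_fst_tuples, simp add: tuples_def\<close>)
    then show ?thesis
      using that by (auto simp: projection_def base_part_def fin_funs_def tuples_def)
  qed
  have comp: "compose_op ?P n f gs \<in> base_part C"
    if f: "(length gs, f) \<in> base_part C" and gs: "\<forall>g\<in>set gs. (n, g) \<in> base_part C" for n f gs
  proof -
    have f_fun: "f \<in> tuples ?P (length gs) \<rightarrow>\<^sub>E ?P" and len: "1 \<le> length gs"
      and f_op: "has_op C (length gs) (\<lambda>xs. (f (map fst xs), 0))"
      using f by (auto simp: base_part_def fin_funs_def)
    have g_op: "has_op C n (\<lambda>xs. ((gs ! i) (map fst xs), 0))" if "i < length gs" for i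
      using gs nth_mem[OF that] by (auto simp: base_part_def)
    have g_fun: "g \<in> tuples ?P n \<rightarrow>\<^sub>E ?P" if "g \<in> set gs" for g
      using gs that by (auto simp: base_part_def fin_funs_def)
    have n: "1 \<le> n"
      using has_op_arity[OF C g_op[of 0]] len by (cases gs) auto
    have args: "map (\<lambda>g. g xs) gs \<in> tuples ?P (length gs)" if "xs \<in> tuples ?P n" for xs
      using PiE_mem[OF g_fun that] by (auto simp: tuples_def)
    have "(\<lambda>xs\<in>tuples ?P n. f (map (\<lambda>g. g xs) gs)) \<in> tuples ?P n \<rightarrow>\<^sub>E ?P"
      using PiE_mem[OF f_fun args] by auto
    moreover have "has_op C n (\<lambda>xs. ((\<lambda>xs\<in>tuples ?P n. f (map (\<lambda>g. g xs) gs)) (map fst xs), 0))"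
    proof (rule has_op_cong[OF has_op_compose[OF C f_op g_op]])
      fix xs assume xs: "xs \<in> tuples A n"
      have "map (\<lambda>i. (gs ! i) (map fst xs)) [0..<length gs] = map (\<lambda>g. g (map fst xs)) gs"
        by (rule nth_equalityI) auto
      then show "(f (map fst (map (\<lambda>i. ((gs ! i) (map fst xs), 0)) [0..<length gs])), 0) =
          ((\<lambda>xs\<in>tuples ?P n. f (map (\<lambda>g. g xs) gs)) (map fst xs), 0)"
        using map_fst_tuples[OF xs] by (simp add: comp_def)
    qed
    ultimately show ?thesis
      using n by (simp add: compose_op_def base_part_def fin_funs_def)
  qed
  have clone: "is_clone ?P (base_part C)"
    unfolding is_clone_def using proj comp by (auto simp: base_part_def)
  have "has_op C 2 (\<lambda>xs. ((\<lambda>xs\<in>tuples ?P 2. xs ! 0 \<oplus>\<^bsub>Zmod p\<^esub> xs ! 1) (map fst xs), 0))"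
  proof (rule has_op_cong[OF has_op_fst[OF C has_op_add[OF C has_op_proj has_op_proj]]])
    show "(fst ((fst (xs ! 0) + fst (xs ! 1)) mod int p, (snd (xs ! 0) + snd (xs ! 1)) mod int q), 0) =
      ((\<lambda>xs\<in>tuples ?P 2. xs ! 0 \<oplus>\<^bsub>Zmod p\<^esub> xs ! 1) (map fst xs), 0)" if "xs \<in> tuples A 2" for xs
      using map_fst_tuples[OF that] that by (simp add: Zmod_add) (simp add: tuples_def)
  qed (simp_all add: C)
  then have "addition_op (Zmod p) \<in> base_part C"
    using p_gt_1
    by (auto simp: addition_op_def base_part_def fin_funs_def Zmod_add Zmod_mod_in_carrier)
  then show ?thesis
    using clone by (auto simp: clones_above_add_def Clo_add_def generated_clone_def)
qed

lemma fin_funs_Zmod_zero: "1 \<le> n \<Longrightarrow> (n, \<lambda>xs\<in>tuples K n. 0) \<in> fin_funs K (carrier (Zmod q))"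
  using q_gt_1 by (auto simp: fin_funs_def Zmod_carrier_iff)

lemma fin_funs_lin_comb:
  "1 \<le> n \<Longrightarrow> (n, \<lambda>xs\<in>tuples K n. (a \<otimes>\<^bsub>Zmod q\<^esub> f xs) \<oplus>\<^bsub>Zmod q\<^esub> (b \<otimes>\<^bsub>Zmod q\<^esub> g xs))
    \<in> fin_funs K (carrier (Zmod q))"
  using q_gt_1 by (auto simp: fin_funs_def Zmod_add Zmod_mod_in_carrier)

lemma fin_funs_mat_vec:
  assumes "1 \<le> n" "(m, f) \<in> fin_funs (carrier (Zmod p)) B"
    "\<forall>i<m. \<forall>j<n. M i j \<in> carrier (Zmod p)"
  shows "(n, \<lambda>xs\<in>tuples (carrier (Zmod p)) n. f (mat_vec (Zmod p) m n M xs))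
    \<in> fin_funs (carrier (Zmod p)) B"
proof -
  have "f \<in> tuples (carrier (Zmod p)) m \<rightarrow>\<^sub>E B" using assms(2) by (simp add: fin_funs_def)
  from PiE_mem[OF this mat_vec_tuples[OF assms(3)]] show ?thesis
    using assms(1) by (auto simp: fin_funs_def)
qed

lemma const_part_clonoid:
  assumes C: "C \<in> clones_above_add (Zprod p q)"
  shows "const_part C \<in> lin_closed_clonoids (Zmod q) (Zmod p)"
proof -
  let ?P = "carrier (Zmod p)"
  have "has_op C 1 (\<lambda>xs. (0, (\<lambda>xs\<in>tuples ?P 1. 0) (map fst xs)))"
    by (rule has_op_cong[OF has_op_zero[OF C]]) (simp_all add: map_fst_tuples del: One_nat_def)
  then have "(1, \<lambda>xs\<in>tuples ?P 1. 0) \<in> const_part C"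
    using fin_funs_Zmod_zero[of 1 ?P] by (simp add: const_part_def)
  then have ne: "const_part C \<noteq> {}" by blast
  have lin: "(n, \<lambda>xs\<in>tuples ?P n. (a \<otimes>\<^bsub>Zmod q\<^esub> f xs) \<oplus>\<^bsub>Zmod q\<^esub> (b \<otimes>\<^bsub>Zmod q\<^esub> g xs)) \<in> const_part C"
    if "(n, f) \<in> const_part C" "(n, g) \<in> const_part C" for n f g a b
  proof -
    have f: "has_op C n (\<lambda>xs. (0, f (map fst xs)))" and g: "has_op C n (\<lambda>xs. (0, g (map fst xs)))"
      using that by (auto simp: const_part_def)
    have "has_op C n (\<lambda>xs. (0, (\<lambda>xs\<in>tuples ?P n.
        (a \<otimes>\<^bsub>Zmod q\<^esub> f xs) \<oplus>\<^bsub>Zmod q\<^esub> (b \<otimes>\<^bsub>Zmod q\<^esub> g xs)) (map fst xs)))"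
      by (rule has_op_cong[OF has_op_lin_comb[OF C f g, of a b]])
        (simp add: map_fst_tuples Zmod_add Zmod_mult mod_simps)
    then show ?thesis
      using fin_funs_lin_comb has_op_arity[OF C f] by (simp add: const_part_def)
  qed
  have mat: "(n, \<lambda>xs\<in>tuples ?P n. f (mat_vec (Zmod p) m n M xs)) \<in> const_part C"
    if n: "1 \<le> n" and f: "(m, f) \<in> const_part C" and M: "\<forall>i<m. \<forall>j<n. M i j \<in> ?P" for m n f M
  proof -
    have f_op: "has_op C m (\<lambda>xs. (0, f (map fst xs)))"
      and f_fun: "(m, f) \<in> fin_funs ?P (carrier (Zmod q))"
      using f by (auto simp: const_part_def)
    have "has_op C n (\<lambda>xs. (map fst xs ! j, 0))" if "j < n" for j
      by (rule has_op_cong[OF has_op_fst[OF C has_op_proj[OF C that]]])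
        (use that in \<open>simp add: tuples_def\<close>)
    then have row: "has_op C n (\<lambda>xs. (mat_vec (Zmod p) m n M (map fst xs) ! i, 0))" if "i < m" for i
      using has_op_mat_vec[OF C n that] by blast
    have "has_op C n (\<lambda>xs. (0, (\<lambda>xs\<in>tuples ?P n. f (mat_vec (Zmod p) m n M xs)) (map fst xs)))"
    proof (rule has_op_cong[OF has_op_compose[OF C f_op row]])
      fix xs assume "xs \<in> tuples A n"
      moreover have "map ((!) (mat_vec (Zmod p) m n M (map fst xs))) [0..<m] =
          mat_vec (Zmod p) m n M (map fst xs)"
        by (rule nth_equalityI) (auto simp: mat_vec_def)
      ultimately show "(0, f (map fst (map (\<lambda>i. (mat_vec (Zmod p) m n M (map fst xs) ! i, 0)) [0..<m]))) =
          (0, (\<lambda>xs\<in>tuples ?P n. f (mat_vec (Zmod p) m n M xs)) (map fst xs))"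
        by (simp add: map_fst_tuples comp_def)
    qed
    then show ?thesis
      using fin_funs_mat_vec[OF n f_fun M] by (simp add: const_part_def)
  qed
  have "const_part C \<subseteq> fin_funs ?P (carrier (Zmod q))" by (auto simp: const_part_def)
  with ne lin mat show ?thesis
    unfolding lin_closed_clonoids_def lin_closed_clonoid_def by blast
qed

text \<open>
  For a substitution \<open>x \<mapsto> M x\<close>, the first \<open>m\<close> arguments of \<open>(0, f(x) y)\<close> are replaced by the entries of
  \<open>M x\<close> while the factor \<open>y\<close>, moved from position \<open>m\<close> to position \<open>n\<close>, stays as it is.
\<close>

lemma coeff_part_clonoid:
  assumes C: "C \<in> clones_above_add (Zprod p q)"
  shows "coeff_part C \<in> lin_closed_clonoids (Zmod q) (Zmod p)"
proof -
  let ?P = "carrier (Zmod p)"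
  let ?term = "\<lambda>n f xs. (0::int, f (map fst (take n xs)) * snd (xs ! n) mod int q)"
  have "has_op C (Suc 1) (?term 1 (\<lambda>xs\<in>tuples ?P 1. 0))"
    by (rule has_op_cong[OF has_op_zero[OF C]]) (simp_all add: map_fst_take_tuples del: One_nat_def)
  then have "(1, \<lambda>xs\<in>tuples ?P 1. 0) \<in> coeff_part C"
    using fin_funs_Zmod_zero[of 1 ?P] by (simp add: coeff_part_def)
  then have ne: "coeff_part C \<noteq> {}" by blast
  have lin: "(n, \<lambda>xs\<in>tuples ?P n. (a \<otimes>\<^bsub>Zmod q\<^esub> f xs) \<oplus>\<^bsub>Zmod q\<^esub> (b \<otimes>\<^bsub>Zmod q\<^esub> g xs)) \<in> coeff_part C"
    if "(n, f) \<in> coeff_part C" "(n, g) \<in> coeff_part C" for n f g a b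
  proof -
    have f: "has_op C (Suc n) (?term n f)" and g: "has_op C (Suc n) (?term n g)"
      and n: "1 \<le> n"
      using that by (auto simp: coeff_part_def fin_funs_def)
    have "has_op C (Suc n) (?term n (\<lambda>xs\<in>tuples ?P n.
        (a \<otimes>\<^bsub>Zmod q\<^esub> f xs) \<oplus>\<^bsub>Zmod q\<^esub> (b \<otimes>\<^bsub>Zmod q\<^esub> g xs)))"
      by (rule has_op_cong[OF has_op_lin_comb[OF C f g, of a b]])
        (simp add: map_fst_take_tuples Zmod_add Zmod_mult mod_lin_comb mod_simps algebra_simps)
    then show ?thesis
      using fin_funs_lin_comb n by (simp add: coeff_part_def)
  qed
  have mat: "(n, \<lambda>xs\<in>tuples ?P n. f (mat_vec (Zmod p) m n M xs)) \<in> coeff_part C"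
    if n: "1 \<le> n" and f: "(m, f) \<in> coeff_part C" and M: "\<forall>i<m. \<forall>j<n. M i j \<in> ?P" for m n f M
  proof -
    have f_op: "has_op C (Suc m) (?term m f)"
      and f_fun: "(m, f) \<in> fin_funs ?P (carrier (Zmod q))"
      using f by (auto simp: coeff_part_def)
    let ?Mx = "\<lambda>xs. mat_vec (Zmod p) m n M (map fst (take n xs))"
    let ?G = "\<lambda>i xs. if i < m then (?Mx xs ! i, 0) else (0, snd (xs ! n))"
    have "has_op C (Suc n) (\<lambda>xs. (map fst (take n xs) ! j, 0))" if "j < n" for j
      by (rule has_op_cong[OF has_op_fst[OF C has_op_proj[OF C less_SucI[OF that]]]])
        (use that in \<open>simp add: tuples_def\<close>)
    then have row: "has_op C (Suc n) (\<lambda>xs. (?Mx xs ! i, 0))" if "i < m" for i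
      using has_op_mat_vec[OF C _ that] by simp
    have G: "has_op C (Suc n) (?G i)" if "i < Suc m" for i
      using row has_op_snd[OF C has_op_proj[OF C, of n "Suc n"]] by (cases "i < m") simp_all
    have "has_op C (Suc n) (?term n (\<lambda>xs\<in>tuples ?P n. f (mat_vec (Zmod p) m n M xs)))"
    proof (rule has_op_cong[OF has_op_compose[OF C f_op G]])
      fix xs assume xs: "xs \<in> tuples A (Suc n)"
      have "map fst (take m (map (\<lambda>i. ?G i xs) [0..<Suc m])) = ?Mx xs"
        by (rule nth_equalityI) (auto simp: mat_vec_def)
      moreover have "map (\<lambda>i. ?G i xs) [0..<Suc m] ! m = (0, snd (xs ! n))"
        by (simp add: nth_append)
      ultimately show "?term m f (map (\<lambda>i. ?G i xs) [0..<Suc m]) =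
          ?term n (\<lambda>xs\<in>tuples ?P n. f (mat_vec (Zmod p) m n M xs)) xs"
        using map_fst_take_tuples[OF xs] by (simp del: upt_Suc)
    qed
    then show ?thesis
      using fin_funs_mat_vec[OF n f_fun M] by (simp add: coeff_part_def)
  qed
  have "coeff_part C \<subseteq> fin_funs ?P (carrier (Zmod q))" by (auto simp: coeff_part_def)
  with ne lin mat show ?thesis
    unfolding lin_closed_clonoids_def lin_closed_clonoid_def by blast
qed

section \<open>Recovering a clone from its three parts\<close>

text \<open>
  The tuples over \<open>A\<close> with first coordinates \<open>u\<close> form a copy of a power of \<open>\<int>\<^sub>q\<close>, with
  coordinates \<open>v\<close>; on each of these fibers the second component of an operation will be affine.
\<close>

definition fiber :: "int list \<Rightarrow> (nat \<Rightarrow> int) \<Rightarrow> (int \<times> int) list" where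
  "fiber u v = map (\<lambda>i. (u ! i, v i)) [0..<length u]"

lemma fiber_tuples:
  assumes "u \<in> tuples (carrier (Zmod p)) n" "\<And>i. i < n \<Longrightarrow> v i \<in> carrier (Zmod q)"
  shows "fiber u v \<in> tuples A n"
proof -
  have "length u = n" using assms(1) by (simp add: tuples_def)
  then show ?thesis
    using tuples_nth[OF assms(1)] assms(2) by (auto simp: fiber_def tuples_def Zprod_carrier_iff)
qed

lemma fiber_cong: "(\<And>i. i < length u \<Longrightarrow> v i = w i) \<Longrightarrow> fiber u v = fiber u w"
  by (simp add: fiber_def)

lemma fiber_eq: "xs \<in> tuples A n \<Longrightarrow> fiber (map fst xs) (\<lambda>i. snd (xs ! i)) = xs"
  by (auto simp: fiber_def tuples_def intro: nth_equalityI)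

lemma has_op_fiber:
  assumes C: "C \<in> clones_above_add (Zprod p q)" and F: "has_op C m F"
    and "\<And>xs. xs \<in> tuples A n \<Longrightarrow> length (U xs) = m"
    and "\<And>i. i < m \<Longrightarrow> has_op C n (\<lambda>xs. (U xs ! i, V xs i))"
  shows "has_op C n (\<lambda>xs. F (fiber (U xs) (V xs)))"
  by (rule has_op_cong[OF has_op_compose[OF C F assms(4)]]) (simp_all add: fiber_def assms(3))

lemma fst_eq_of_pi1:
  assumes pres: "preserves_pi1 p q C" and F: "has_op C n F"
    and x: "xs \<in> tuples A n" and y: "ys \<in> tuples A n" and eq: "map fst xs = map fst ys"
  shows "fst (F xs) = fst (F ys)"
proof -
  let ?R = "{[a, b] | a b. (a, b) \<in> pi1 p q}"
  let ?ts = "map (\<lambda>i. [xs ! i, ys ! i]) [0..<n]"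
  have len: "length xs = n" "length ys = n" using x y by (auto simp: tuples_def)
  have "fst (xs ! i) = fst (ys ! i)" if "i < n" for i
    using eq that len by (metis nth_map)
  then have "(xs ! i, ys ! i) \<in> pi1 p q" if "i < n" for i
    using tuples_nth[OF x that] tuples_nth[OF y that] that by (simp add: pi1_def)
  then have sub: "set ?ts \<subseteq> ?R" by (auto simp del: split_paired_Ex)
  have pres': "preserves (n, restrict F (tuples A n)) 2 ?R"
    using bspec[OF pres[unfolded preserves_pi1_def clone_preserves_def] F[unfolded has_op_def]] .
  have "map (\<lambda>i. restrict F (tuples A n) (map (\<lambda>t. t ! i) ?ts)) [0..<2] \<in> ?R"
    by (rule preservesD[OF pres' _ sub]) simp
  moreover have "map (\<lambda>t. t ! 0) ?ts = xs" "map (\<lambda>t. t ! 1) ?ts = ys"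
    using len by (auto intro: nth_equalityI)
  ultimately show ?thesis
    using x y by (auto simp: pi1_def upt_rec numeral_2_eq_2)
qed

text \<open>
  The points of a fiber with coordinates \<open>v1\<close>, \<open>v2\<close>, \<open>v3\<close> and \<open>v4 = v1 - v2 + v3\<close> are the four columns
  of a list of tuples in the commutator relation.
\<close>

lemma snd_affine_of_commutator:
  assumes pres: "preserves_pi1_commutator p q C" and C: "C \<in> clones_above_add (Zprod p q)"
    and F: "has_op C n F" and u: "u \<in> tuples (carrier (Zmod p)) n"
    and v: "\<And>i. i < n \<Longrightarrow> v1 i \<in> carrier (Zmod q)" "\<And>i. i < n \<Longrightarrow> v2 i \<in> carrier (Zmod q)"
      "\<And>i. i < n \<Longrightarrow> v3 i \<in> carrier (Zmod q)"
    and v4: "\<And>i. i < n \<Longrightarrow> v4 i = (v1 i - v2 i + v3 i) mod int q"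
  shows "snd (F (fiber u v4)) =
    (snd (F (fiber u v1)) - snd (F (fiber u v2)) + snd (F (fiber u v3))) mod int q"
proof -
  let ?R = "{[a, b, c, d] | a b c d. a \<in> A \<and> b \<in> A \<and> c \<in> A \<and> d \<in> A \<and>
    (a, b) \<in> pi1 p q \<and> (b, c) \<in> pi1 p q \<and> (a \<ominus>\<^bsub>Zprod p q\<^esub> b) \<oplus>\<^bsub>Zprod p q\<^esub> c = d}"
  let ?ts = "map (\<lambda>i. [(u ! i, v1 i), (u ! i, v2 i), (u ! i, v3 i), (u ! i, v4 i)]) [0..<n]"
  have len: "length u = n" using u by (simp add: tuples_def)
  have u_in: "u ! i \<in> carrier (Zmod p)" if "i < n" for i
    using u that by (auto simp: tuples_def)
  have v4_in: "v4 i \<in> carrier (Zmod q)" if "i < n" for i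
    using v4[OF that] q_gt_1 by (simp add: Zmod_mod_in_carrier)
  have "[(u ! i, v1 i), (u ! i, v2 i), (u ! i, v3 i), (u ! i, v4 i)] \<in> ?R" if "i < n" for i
  proof -
    have "((u ! i, v1 i) \<ominus>\<^bsub>Zprod p q\<^esub> (u ! i, v2 i)) \<oplus>\<^bsub>Zprod p q\<^esub> (u ! i, v3 i) = (u ! i, v4 i)"
      using u_in[OF that] v(1-3)[OF that] v4[OF that]
      by (simp add: Zprod_minus Zprod_carrier_iff Zprod_add Zmod_mod_id mod_simps)
    then show ?thesis
      using u_in[OF that] v(1-3)[OF that] v4_in[OF that]
      by (simp add: pi1_def Zprod_carrier_iff)
  qed
  then have sub: "set ?ts \<subseteq> ?R" by auto
  have pres': "preserves (n, restrict F (tuples A n)) 4 ?R"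
    using bspec[OF pres[unfolded preserves_pi1_commutator_def clone_preserves_def] F[unfolded has_op_def]] .
  have res: "map (\<lambda>i. restrict F (tuples A n) (map (\<lambda>t. t ! i) ?ts)) [0..<4] \<in> ?R"
    by (rule preservesD[OF pres' _ sub]) simp
  have cols: "map (\<lambda>t. t ! 0) ?ts = fiber u v1" "map (\<lambda>t. t ! 1) ?ts = fiber u v2"
    "map (\<lambda>t. t ! 2) ?ts = fiber u v3" "map (\<lambda>t. t ! 3) ?ts = fiber u v4"
    using len by (auto simp: fiber_def)
  have "[0..<4] = [0, 1, 2, 3]" by (simp add: upt_rec)
  moreover have "fiber u v1 \<in> tuples A n" "fiber u v2 \<in> tuples A n" "fiber u v3 \<in> tuples A n"
    "fiber u v4 \<in> tuples A n"
    using fiber_tuples[OF u] v v4_in by auto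
  ultimately have "[F (fiber u v1), F (fiber u v2), F (fiber u v3), F (fiber u v4)] \<in> ?R"
    using res by (simp only: list.map cols restrict_apply if_True)
  then show ?thesis
    by (auto simp: Zprod_minus Zprod_add mod_simps)
qed

text \<open>The coefficient \<open>g\<^sub>k(u)\<close> of the \<open>k\<close>-th second coordinate on the fiber over \<open>u\<close>.\<close>

definition slope :: "((int \<times> int) list \<Rightarrow> int \<times> int) \<Rightarrow> nat \<Rightarrow> int list \<Rightarrow> int" where
  "slope F k u =
     (snd (F (fiber u (\<lambda>i. if i = k then 1 else 0))) - snd (F (fiber u (\<lambda>_. 0)))) mod int q"

text \<open>
  On the \<open>k\<close>-th axis \<open>snd_affine_of_commutator\<close> gives \<open>f((t + 1) e\<^sub>k) = f(t e\<^sub>k) - f(0) + f(e\<^sub>k)\<close>, and every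
  element of \<open>\<int>\<^sub>q\<close> is reached from \<open>0\<close> by adding \<open>1\<close>.
\<close>

lemma snd_on_axis:
  assumes pres: "preserves_pi1_commutator p q C" and C: "C \<in> clones_above_add (Zprod p q)"
    and F: "has_op C n F" and u: "u \<in> tuples (carrier (Zmod p)) n"
    and y: "y \<in> carrier (Zmod q)"
  shows "snd (F (fiber u (\<lambda>i. if i = k then y else 0))) =
    (snd (F (fiber u (\<lambda>_. 0))) + slope F k u * y) mod int q"
proof -
  let ?a = "\<lambda>y. snd (F (fiber u (\<lambda>i. if i = k then y else 0)))"
  let ?b = "snd (F (fiber u (\<lambda>_. 0)))"
  have "?a (int t) = (?b + slope F k u * int t) mod int q" if "t < q" for t
    using that
  proof (induction t)
    case 0
    have "F (fiber u (\<lambda>_. 0)) \<in> A"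
      using q_gt_1 by (intro has_op_closed[OF C F] fiber_tuples[OF u]) (simp add: Zmod_carrier_iff)
    then show ?case by (simp add: Zprod_carrier_iff Zmod_mod_id cong: if_cong)
  next
    case (Suc t)
    have "?a (int (Suc t)) = (?a (int t) - ?b + ?a 1) mod int q"
      using Suc.prems q_gt_1
      by (intro snd_affine_of_commutator[OF pres C F u]) (auto simp: Zmod_carrier_iff)
    also have "\<dots> = (?b + slope F k u * int t - ?b + ?a 1) mod int q"
      using Suc by (simp add: mod_diff_add_left)
    also have "\<dots> = (?b + slope F k u * int t + slope F k u) mod int q"
    proof -
      have slope: "(?a 1 - ?b) mod int q = slope F k u" by (simp add: slope_def)
      show ?thesis
        using mod_add_right_eq[of "?b + slope F k u * int t" "?a 1 - ?b" "int q"]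
        unfolding slope by simp
    qed
    finally show ?case by (simp add: algebra_simps)
  qed
  from this[of "nat y"] show ?thesis
    using y by (simp add: Zmod_carrier_iff nat_less_iff cong: if_cong)
qed

lemma parts_at_zero:
  assumes C: "C \<in> clones_above_add (Zprod p q)" and F: "has_op C n F"
  shows "(n, \<lambda>u\<in>tuples (carrier (Zmod p)) n. fst (F (fiber u (\<lambda>_. 0)))) \<in> base_part C"
    and "(n, \<lambda>u\<in>tuples (carrier (Zmod p)) n. snd (F (fiber u (\<lambda>_. 0)))) \<in> const_part C"
proof -
  let ?P = "carrier (Zmod p)"
  have op: "has_op C n (\<lambda>xs. F (fiber (map fst xs) (\<lambda>_. 0)))"
  proof (rule has_op_fiber[OF C F])
    show "has_op C n (\<lambda>xs. (map fst xs ! i, 0))" if "i < n" for i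
      by (rule has_op_cong[OF has_op_fst[OF C has_op_proj[OF C that]]])
        (use that in \<open>simp add: tuples_def\<close>)
  qed (simp add: tuples_def)
  have "F (fiber u (\<lambda>_. 0)) \<in> A" if "u \<in> tuples ?P n" for u
    using q_gt_1 by (intro has_op_closed[OF C F] fiber_tuples[OF that]) (simp add: Zmod_carrier_iff)
  then have "(n, \<lambda>u\<in>tuples ?P n. fst (F (fiber u (\<lambda>_. 0)))) \<in> fin_funs ?P ?P"
    "(n, \<lambda>u\<in>tuples ?P n. snd (F (fiber u (\<lambda>_. 0)))) \<in> fin_funs ?P (carrier (Zmod q))"
    using has_op_arity[OF C F] by (auto simp: fin_funs_def Zprod_carrier_iff)
  moreover have "has_op C n (\<lambda>xs. ((\<lambda>u\<in>tuples ?P n. fst (F (fiber u (\<lambda>_. 0)))) (map fst xs), 0))"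
    by (rule has_op_cong[OF has_op_fst[OF C op]]) (simp add: map_fst_tuples)
  moreover have "has_op C n (\<lambda>xs. (0, (\<lambda>u\<in>tuples ?P n. snd (F (fiber u (\<lambda>_. 0)))) (map fst xs)))"
    by (rule has_op_cong[OF has_op_snd[OF C op]]) (simp add: map_fst_tuples)
  ultimately show
    "(n, \<lambda>u\<in>tuples ?P n. fst (F (fiber u (\<lambda>_. 0)))) \<in> base_part C"
    "(n, \<lambda>u\<in>tuples ?P n. snd (F (fiber u (\<lambda>_. 0)))) \<in> const_part C"
    by (simp_all add: base_part_def const_part_def)
qed

text \<open>
  Substituting \<open>(x\<^sub>k, y\<^sub>n\<^sub>+\<^sub>1)\<close> for the \<open>k\<close>-th argument and \<open>(x\<^sub>i, 0)\<close> for the others, and subtracting the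
  value at zero second coordinates, leaves \<open>g\<^sub>k(x) y\<^sub>n\<^sub>+\<^sub>1\<close>.
\<close>

lemma slope_in_coeff_part:
  assumes pres: "preserves_pi1_commutator p q C" and C: "C \<in> clones_above_add (Zprod p q)"
    and F: "has_op C n F" and k: "k < n"
  shows "(n, \<lambda>u\<in>tuples (carrier (Zmod p)) n. slope F k u) \<in> coeff_part C"
proof -
  let ?P = "carrier (Zmod p)"
  let ?u = "\<lambda>xs. map fst (take n xs)"
  have proj: "has_op C (Suc n) (\<lambda>xs. (?u xs ! i, 0))" if "i < n" for i
    by (rule has_op_cong[OF has_op_fst[OF C has_op_proj[OF C less_SucI[OF that]]]])
      (use that in \<open>simp add: tuples_def\<close>)
  have new: "has_op C (Suc n) (\<lambda>xs. (0, snd (xs ! n)))"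
    by (rule has_op_snd[OF C has_op_proj[OF C]]) simp
  have axis: "has_op C (Suc n) (\<lambda>xs. (0, snd (F (fiber (?u xs) (\<lambda>i. if i = k then snd (xs ! n) else 0)))))"
  proof (rule has_op_snd[OF C has_op_fiber[OF C F]])
    show "has_op C (Suc n) (\<lambda>xs. (?u xs ! i, if i = k then snd (xs ! n) else 0))" if "i < n" for i
      using proj[OF that] has_op_pair[OF C proj[OF that] new] by (cases "i = k") simp_all
  qed (simp add: tuples_def)
  have origin: "has_op C (Suc n) (\<lambda>xs. (0, snd (F (fiber (?u xs) (\<lambda>_. 0)))))"
    by (rule has_op_snd[OF C has_op_fiber[OF C F]]) (simp_all add: tuples_def proj)
  have "has_op C (Suc n) (\<lambda>xs. (0, (\<lambda>u\<in>tuples ?P n. slope F k u) (?u xs) * snd (xs ! n) mod int q))"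
  proof (rule has_op_cong[OF has_op_lin_comb[OF C axis origin, of 1 "-1"]])
    fix xs assume xs: "xs \<in> tuples A (Suc n)"
    then have "snd (xs ! n) \<in> carrier (Zmod q)"
      using tuples_nth[OF xs, of n] by (simp add: Zprod_carrier_iff)
    from snd_on_axis[OF pres C F map_fst_take_tuples[OF xs] this, of k]
    show "(0, (1 * snd (F (fiber (?u xs) (\<lambda>i. if i = k then snd (xs ! n) else 0))) +
          - 1 * snd (F (fiber (?u xs) (\<lambda>_. 0)))) mod int q) =
        (0, (\<lambda>u\<in>tuples ?P n. slope F k u) (?u xs) * snd (xs ! n) mod int q)"
      using map_fst_take_tuples[OF xs] by (simp add: mod_simps)
  qed
  moreover have "(n, \<lambda>u\<in>tuples ?P n. slope F k u) \<in> fin_funs ?P (carrier (Zmod q))"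
    using k q_gt_1 by (auto simp: fin_funs_def slope_def Zmod_mod_in_carrier)
  ultimately show ?thesis by (simp add: coeff_part_def)
qed

text \<open>
  An operation of \<open>C\<close> is rebuilt inside \<open>D\<close> by induction on \<open>k\<close>, after replacing all second coordinates
  from position \<open>k\<close> on by \<open>0\<close>. For \<open>k = 0\<close> only the base and constant parts remain, and each step
  adds one term \<open>g\<^sub>k(x) y\<^sub>k\<close>.
\<close>

lemma clone_subset_of_parts_subset:
  assumes C: "C \<in> clones_above_add (Zprod p q)" and D: "D \<in> clones_above_add (Zprod p q)"
    and pi1: "preserves_pi1 p q C" and comm: "preserves_pi1_commutator p q C"
    and base: "base_part C \<subseteq> base_part D" and const: "const_part C \<subseteq> const_part D"
    and coeff: "coeff_part C \<subseteq> coeff_part D"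
  shows "C \<subseteq> D"
proof
  fix h assume "h \<in> C"
  then obtain n F where h: "h = (n, F)" and F: "has_op C n F" and ext: "F \<in> extensional (tuples A n)"
    using has_op_iff[OF C] by (cases h) auto
  let ?P = "carrier (Zmod p)"
  let ?y = "\<lambda>k xs i. if i < k then snd (xs ! i) else 0"
  have y_in: "?y k xs i \<in> carrier (Zmod q)" if "xs \<in> tuples A n" "i < n" for k xs i
    using tuples_nth[OF that] q_gt_1 by (simp add: Zprod_carrier_iff Zmod_carrier_iff)
  have "has_op D n (\<lambda>xs. F (fiber (map fst xs) (?y k xs)))" if "k \<le> n" for k
    using that
  proof (induction k)
    case 0
    have "(n, \<lambda>u\<in>tuples ?P n. fst (F (fiber u (\<lambda>_. 0)))) \<in> base_part D"
      "(n, \<lambda>u\<in>tuples ?P n. snd (F (fiber u (\<lambda>_. 0)))) \<in> const_part D"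
      using parts_at_zero[OF C F] base const by auto
    then have "has_op D n (\<lambda>xs. ((\<lambda>u\<in>tuples ?P n. fst (F (fiber u (\<lambda>_. 0)))) (map fst xs), 0))"
      "has_op D n (\<lambda>xs. (0, (\<lambda>u\<in>tuples ?P n. snd (F (fiber u (\<lambda>_. 0)))) (map fst xs)))"
      by (simp_all only: base_part_def const_part_def mem_Collect_eq case_prod_conv)
    from has_op_pair[OF D this] show ?case
      by (rule has_op_cong) (simp add: map_fst_tuples)
  next
    case (Suc k)
    then have k: "k < n" and IH: "has_op D n (\<lambda>xs. F (fiber (map fst xs) (?y k xs)))" by simp_all
    have "(n, \<lambda>u\<in>tuples ?P n. slope F k u) \<in> coeff_part D"
      using slope_in_coeff_part[OF comm C F k] coeff by auto
    then have slope: "has_op D (Suc n) (\<lambda>xs. (0,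
        (\<lambda>u\<in>tuples ?P n. slope F k u) (map fst (take n xs)) * snd (xs ! n) mod int q))"
      by (simp only: coeff_part_def mem_Collect_eq case_prod_conv)
    \<comment> \<open>Identifying the extra last argument with the \<open>k\<close>-th one turns \<open>g\<^sub>k(x) y\<^sub>n\<^sub>+\<^sub>1\<close> into \<open>g\<^sub>k(x) y\<^sub>k\<close>.\<close>
    have "has_op D n (\<lambda>xs. xs ! (if i < n then i else k))" for i
      using k by (intro has_op_proj[OF D]) auto
    from has_op_compose[OF D slope this]
    have "has_op D n (\<lambda>xs. (0, slope F k (map fst xs) * snd (xs ! k) mod int q))"
    proof (rule has_op_cong)
      fix xs assume xs: "xs \<in> tuples A n"
      have "take n (map (\<lambda>i. xs ! (if i < n then i else k)) [0..<Suc n]) = xs"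
        using xs by (intro nth_equalityI) (auto simp: tuples_def nth_append)
      moreover have "map (\<lambda>i. xs ! (if i < n then i else k)) [0..<Suc n] ! n = xs ! k"
        by (simp add: nth_append)
      ultimately show "(0, (\<lambda>u\<in>tuples ?P n. slope F k u)
            (map fst (take n (map (\<lambda>i. xs ! (if i < n then i else k)) [0..<Suc n]))) *
          snd (map (\<lambda>i. xs ! (if i < n then i else k)) [0..<Suc n] ! n) mod int q) =
        (0, slope F k (map fst xs) * snd (xs ! k) mod int q)"
        using map_fst_tuples[OF xs] by (simp del: upt_Suc)
    qed
    from has_op_add[OF D IH this] show ?case
    proof (rule has_op_cong)
      fix xs assume xs: "xs \<in> tuples A n"
      let ?u = "map fst xs"
      let ?F = "\<lambda>v. F (fiber ?u v)" and ?e = "\<lambda>i. if i = k then snd (xs ! k) else 0"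
      have u: "?u \<in> tuples ?P n" using map_fst_tuples[OF xs] .
      have tup: "fiber ?u (?y j xs) \<in> tuples A n" for j
        using fiber_tuples[OF u y_in[OF xs]] .
      have F_in: "?F (?y j xs) \<in> A" for j
        using has_op_closed[OF C F tup] .
      have yk: "snd (xs ! k) \<in> carrier (Zmod q)"
        using y_in[OF xs k, of "Suc k"] by simp
      have "fst (?F (?y (Suc k) xs)) = fst (?F (?y k xs))"
        by (rule fst_eq_of_pi1[OF pi1 F tup tup]) (simp add: fiber_def comp_def)
      \<comment> \<open>The truncation at \<open>k + 1\<close> is the truncation at \<open>k\<close>, minus the origin, plus a point of the
        \<open>k\<close>-th axis.\<close>
      moreover have "snd (?F (?y (Suc k) xs)) =
          (snd (?F (?y k xs)) - snd (?F (\<lambda>_. 0)) + snd (?F ?e)) mod int q"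
        using y_in[OF xs] yk q_gt_1
        by (intro snd_affine_of_commutator[OF comm C F u])
          (auto simp: Zmod_carrier_iff less_Suc_eq)
      then have "snd (?F (?y (Suc k) xs)) =
          (snd (?F (?y k xs)) + slope F k ?u * snd (xs ! k)) mod int q"
        unfolding snd_on_axis[OF comm C F u yk] by (simp add: mod_simps)
      ultimately show
        "((fst (?F (?y k xs)) + fst (0::int, slope F k ?u * snd (xs ! k) mod int q)) mod int p,
          (snd (?F (?y k xs)) + snd (0::int, slope F k ?u * snd (xs ! k) mod int q)) mod int q) =
         ?F (?y (Suc k) xs)"
        using F_in[of k] by (simp add: prod_eq_iff mod_simps Zprod_carrier_iff Zmod_mod_id)
    qed
  qed
  from this[of n] have "has_op D n F"
  proof (rule has_op_cong)
    fix xs assume xs: "xs \<in> tuples A n"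
    have "fiber (map fst xs) (?y n xs) = fiber (map fst xs) (\<lambda>i. snd (xs ! i))"
      using xs by (intro fiber_cong) (simp add: tuples_def)
    then show "F (fiber (map fst xs) (?y n xs)) = F xs"
      using fiber_eq[OF xs] by simp
  qed simp
  then show "h \<in> D" using h ext has_op_iff[OF D] by simp
qed

end

theorem theorem1p7:
  fixes p q :: nat
  assumes "prime p" and "prime q" and "p \<noteq> q"
  shows "\<exists>\<Phi>.
    \<Phi> \<in> {C \<in> clones_above_add (Zprod p q). preserves_pi1 p q C \<and> preserves_pi1_commutator p q C}
        \<rightarrow> clones_above_add (Zmod p) \<times>
           (lin_closed_clonoids (Zmod q) (Zmod p) \<times> lin_closed_clonoids (Zmod q) (Zmod p)) \<and>
    inj_on \<Phi>
      {C \<in> clones_above_add (Zprod p q). preserves_pi1 p q C \<and> preserves_pi1_commutator p q C}"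
proof -
  interpret coprime_moduli p q
    using assms by unfold_locales (auto intro: primes_coprime prime_gt_Suc_0_nat)
  show ?thesis
  proof (intro exI[of _ "\<lambda>C. (base_part C, const_part C, coeff_part C)"] conjI)
    show "(\<lambda>C. (base_part C, const_part C, coeff_part C))
        \<in> {C \<in> clones_above_add (Zprod p q). preserves_pi1 p q C \<and> preserves_pi1_commutator p q C}
        \<rightarrow> clones_above_add (Zmod p) \<times>
           (lin_closed_clonoids (Zmod q) (Zmod p) \<times> lin_closed_clonoids (Zmod q) (Zmod p))"
      using base_part_clone const_part_clonoid coeff_part_clonoid by auto
    show "inj_on (\<lambda>C. (base_part C, const_part C, coeff_part C))
        {C \<in> clones_above_add (Zprod p q). preserves_pi1 p q C \<and> preserves_pi1_commutator p q C}"
      by (rule inj_onI) (auto intro!: equalityI clone_subset_of_parts_subset del: subsetI)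
  qed
qed

end
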